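(* Let $N,s\ge1$, let $M_1,\dots,M_N,\widehat M\in\mathbb{R}^{s\times s}$, and let $D_i=\widehat M-M_i$ for $i=1,\dots,N$. Let $\mathbf{L}$ and $\widehat{\mathbf{L}}$ be the block bidiagonal matrices defined in the context. Then the eigenvalues of $\widehat{\mathbf{L}}^{-T}\mathbf{L}^T\mathbf{L}\widehat{\mathbf{L}}^{-1}$ can be bounded above by $$1+\frac N2\left(\rho_N+\sqrt{\rho_N^2+4\rho_N}\right),$$ where $$\rho_N=\begin{cases} N\cdot\max_{m=1,\dots,N}\lambda_{\max}(D_m^TD_m), & \text{if }\lambda_{\max}(\widehat M^T\widehat M)=1,\\[2mm] \dfrac{1-\lambda_{\max}^N(\widehat M^T\widehat M)}{1-\lambda_{\max}(\widehat M^T\widehat M)}\cdot\max_{m=1,\dots,N}\lambda_{\max}(D_m^TD_m), & \text{otherwise.}\end{cases}$$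
   Context: $\mathbf{L}\in\mathbb{R}^{(N+1)s\times(N+1)s}$ is the block lower bidiagonal matrix with $I_s$ in every diagonal block, $-M_i$ in block position $(i+1,i)$ for $i=1,\dots,N$, and zero blocks elsewhere. $\widehat{\mathbf{L}}=I_{N+1}\otimes I_s-\Sigma\otimes\widehat M$, where $\Sigma\in\mathbb{R}^{(N+1)\times(N+1)}$ has ones on the first subdiagonal and zeros elsewhere; i.e. $\widehat{\mathbf{L}}$ is obtained from $\mathbf{L}$ by replacing every $M_i$ with $\widehat M$. $\lambda_{\max}(\cdot)$ denotes the largest eigenvalue of a symmetric matrix, and $\lambda_{\max}^N(\cdot)=(\lambda_{\max}(\cdot))^N$. *)

theory Defs
  imports
    "Jordan_Normal_Form.Gauss_Jordan_Elimination"
    "Jordan_Normal_Form.Determinant"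
    "Jordan_Normal_Form.Spectral_Radius"
begin

text \<open>Only meaningful when the real spectrum is nonempty, e.g. for a symmetric matrix of positive
  dimension.\<close>

definition lambda_max :: "real mat \<Rightarrow> real" where
  "lambda_max A = Max (spectrum A)"

definition inv_mat :: "'a :: field mat \<Rightarrow> 'a mat" where
  "inv_mat A = the (mat_inverse A)"

definition kronecker :: "'a :: semiring_0 mat \<Rightarrow> 'a mat \<Rightarrow> 'a mat" where
  "kronecker A B = mat (dim_row A * dim_row B) (dim_col A * dim_col B)
     (\<lambda>(i, j). A $$ (i div dim_row B, j div dim_col B) * B $$ (i mod dim_row B, j mod dim_col B))"

definition subdiag_mat :: "nat \<Rightarrow> real mat" where
  "subdiag_mat n = mat n n (\<lambda>(i, j). if i = j + 1 then 1 else 0)"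

text \<open>Blocks are counted from 0 here, so the block in (1-based) position (k+1, k) has 0-based
  row k and column k-1; it is \<open>- M k\<close> for k = 1..N.\<close>

definition L_mat :: "nat \<Rightarrow> nat \<Rightarrow> (nat \<Rightarrow> real mat) \<Rightarrow> real mat" where
  "L_mat N s M = mat ((N + 1) * s) ((N + 1) * s) (\<lambda>(i, j).
     if i div s = j div s then 1\<^sub>m s $$ (i mod s, j mod s)
     else if i div s = j div s + 1 then - (M (i div s) $$ (i mod s, j mod s))
     else 0)"

definition Lhat_mat :: "nat \<Rightarrow> nat \<Rightarrow> real mat \<Rightarrow> real mat" where
  "Lhat_mat N s Mhat =
     kronecker (1\<^sub>m (N + 1)) (1\<^sub>m s) - kronecker (subdiag_mat (N + 1)) Mhat"

definition rho :: "nat \<Rightarrow> real mat \<Rightarrow> (nat \<Rightarrow> real mat) \<Rightarrow> real" where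
  "rho N Mhat D =
     (let l = lambda_max (Mhat\<^sup>T * Mhat);
          d = (MAX m\<in>{1..N}. lambda_max ((D m)\<^sup>T * D m))
      in if l = 1 then real N * d else (1 - l ^ N) / (1 - l) * d)"

lemma Lhat_mat_eq_L_mat:
  assumes "Mhat \<in> carrier_mat s s"
  shows "Lhat_mat N s Mhat = L_mat N s (\<lambda>_. Mhat)"
proof (rule eq_matI)
  fix i j
  assume "i < dim_row (L_mat N s (\<lambda>_. Mhat))" "j < dim_col (L_mat N s (\<lambda>_. Mhat))"
  then have ij: "i < (N + 1) * s" "j < (N + 1) * s" by (auto simp: L_mat_def)
  then have s: "s > 0" by (cases s) auto
  have b: "i div s < Suc N" "j div s < Suc N" "i mod s < s" "j mod s < s"
    using ij s by (auto simp: less_mult_imp_div_less)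
  then show "Lhat_mat N s Mhat $$ (i, j) = L_mat N s (\<lambda>_. Mhat) $$ (i, j)"
    using ij assms unfolding Lhat_mat_def L_mat_def kronecker_def subdiag_mat_def
    by auto
qed (use assms in \<open>auto simp: Lhat_mat_def L_mat_def kronecker_def subdiag_mat_def\<close>)

lemma det_L_mat: "det (L_mat N s M) = 1"
proof -
  have c: "L_mat N s M \<in> carrier_mat ((N + 1) * s) ((N + 1) * s)"
    by (simp add: L_mat_def)
  have z: "L_mat N s M $$ (i, j) = 0" if "i < j" "j < (N + 1) * s" for i j
  proof -
    have "i div s \<le> j div s" using that(1) by (simp add: div_le_mono)
    moreover have "s > 0" using that(2) by (cases s) auto
    moreover have "i mod s \<noteq> j mod s" if "i div s = j div s"
      using that \<open>i < j\<close> by (metis div_mult_mod_eq less_irrefl)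
    ultimately show ?thesis using that by (auto simp: L_mat_def)
  qed
  have "diag_mat (L_mat N s M) = map (\<lambda>_. 1) [0..<(N + 1) * s]"
    unfolding diag_mat_def
  proof (rule map_cong)
    fix i assume "i \<in> set [0..<(N + 1) * s]"
    then have i: "i < (N + 1) * s" by simp
    then have "s > 0" by (cases s) auto
    then show "L_mat N s M $$ (i, i) = 1" using i by (simp add: L_mat_def)
  qed (use c in auto)
  also have "prod_list \<dots> = 1" by (induction "(N + 1) * s") (auto simp: map_replicate_const)
  finally show ?thesis using det_lower_triangular[OF z c] by simp
qed

lemma inv_mat_Lhat:
  assumes "Mhat \<in> carrier_mat s s"
  shows "inv_mat (Lhat_mat N s Mhat) \<in> carrier_mat ((N + 1) * s) ((N + 1) * s)"
    and "Lhat_mat N s Mhat * inv_mat (Lhat_mat N s Mhat) = 1\<^sub>m ((N + 1) * s)"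
    and "inv_mat (Lhat_mat N s Mhat) * Lhat_mat N s Mhat = 1\<^sub>m ((N + 1) * s)"
proof -
  let ?n = "(N + 1) * s"
  have c: "Lhat_mat N s Mhat \<in> carrier_mat ?n ?n"
    unfolding Lhat_mat_eq_L_mat[OF assms] by (simp add: L_mat_def)
  have "det (Lhat_mat N s Mhat) \<noteq> 0"
    unfolding Lhat_mat_eq_L_mat[OF assms] det_L_mat by simp
  then have "mat_inverse (Lhat_mat N s Mhat) \<noteq> None"
    using det_non_zero_imp_unit[OF c, of "()"] mat_inverse(1)[OF c, of "()"] by blast
  then obtain B where B: "mat_inverse (Lhat_mat N s Mhat) = Some B" by blast
  show "inv_mat (Lhat_mat N s Mhat) \<in> carrier_mat ?n ?n"
    "Lhat_mat N s Mhat * inv_mat (Lhat_mat N s Mhat) = 1\<^sub>m ?n"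
    "inv_mat (Lhat_mat N s Mhat) * Lhat_mat N s Mhat = 1\<^sub>m ?n"
    using mat_inverse(2)[OF c B] B by (simp_all add: inv_mat_def)
qed

end

theory Submission
  imports Defs "HOL-Analysis.Function_Topology" "HOL-Analysis.Convex"
begin

unbundle no inner_syntax

text \<open>
  If \<open>v\<close> is an eigenvector for \<open>\<mu>\<close> and \<open>w = Lhat\<^sup>-\<^sup>1 v\<close>, then \<open>\<mu> \<bar>v\<bar>\<^sup>2 = \<bar>L w\<bar>\<^sup>2\<close>, so it suffices to compare
  \<open>L w\<close> with \<open>v = Lhat w\<close>. Blockwise, \<open>w\<^sub>k = v\<^sub>k + Mhat w\<^sub>k\<^sub>-\<^sub>1\<close> and \<open>(L w)\<^sub>k = v\<^sub>k + D\<^sub>k w\<^sub>k\<^sub>-\<^sub>1\<close>. With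
  \<open>S\<^sub>k = \<bar>v\<^sub>0\<bar>\<^sup>2 + \<dots> + \<bar>v\<^sub>k\<bar>\<^sup>2\<close> and \<open>l = \<lambda>\<^sub>m\<^sub>a\<^sub>x (Mhat\<^sup>T Mhat)\<close>, the recursion gives
  \<open>\<bar>w\<^sub>k\<bar>\<^sup>2 \<le> (1 + l + \<dots> + l\<^sup>k) S\<^sub>k\<close>, hence \<open>\<bar>D\<^sub>k w\<^sub>k\<^sub>-\<^sub>1\<bar>\<^sup>2 \<le> \<rho> S\<^sub>k\<^sub>-\<^sub>1\<close>. The number
  \<open>c = (\<rho> + sqrt (\<rho>\<^sup>2 + 4 \<rho>)) / 2\<close> is the largest eigenvalue of the form \<open>2 \<surd>\<rho> x y + \<rho> y\<^sup>2\<close>, so that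
  \<open>\<bar>(L w)\<^sub>k\<bar>\<^sup>2 \<le> \<bar>v\<^sub>k\<bar>\<^sup>2 + c (\<bar>v\<^sub>k\<bar>\<^sup>2 + S\<^sub>k\<^sub>-\<^sub>1) \<le> \<bar>v\<^sub>k\<bar>\<^sup>2 + c \<bar>v\<bar>\<^sup>2\<close>; summing over the \<open>N\<close> blocks with \<open>k \<ge> 1\<close>
  yields \<open>\<bar>L w\<bar>\<^sup>2 \<le> (1 + N c) \<bar>v\<bar>\<^sup>2\<close>.
\<close>

section \<open>Norm inequalities for real vectors\<close>

lemma scalar_prod_self_nonneg: "0 \<le> x \<bullet> (x :: real vec)"
  using conjugate_square_ge_0_vec[of x] by simp

lemma scalar_prod_self_eq_0_iff:
  fixes x :: "real vec"
  assumes "x \<in> carrier_vec n"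
  shows "x \<bullet> x = 0 \<longleftrightarrow> x = 0\<^sub>v n"
  using conjugate_square_eq_0_vec[OF assms] by simp

lemma scalar_prod_self_add:
  fixes x y :: "real vec"
  assumes "x \<in> carrier_vec n" "y \<in> carrier_vec n"
  shows "(x + y) \<bullet> (x + y) = x \<bullet> x + 2 * (x \<bullet> y) + y \<bullet> y"
  using assms comm_scalar_prod[OF assms]
  by (simp add: add_scalar_prod_distrib[of _ n] scalar_prod_add_distrib[of _ n])

lemma scalar_prod_Cauchy_Schwarz:
  fixes x y :: "real vec"
  assumes "x \<in> carrier_vec n" "y \<in> carrier_vec n"
  shows "(x \<bullet> y)\<^sup>2 \<le> (x \<bullet> x) * (y \<bullet> y)"
  using assms Cauchy_Schwarz_ineq_sum[of "\<lambda>i. x $ i" "\<lambda>i. y $ i" "{0..<n}"]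
  by (simp add: scalar_prod_def power2_eq_square)

text \<open>Cauchy-Schwarz followed by \<open>4 * p * q \<le> (p + q)\<^sup>2\<close> with
  \<open>p = a * (x \<bullet> x)\<close> and \<open>q = b * S\<close>. Bounding \<open>y\<close>
  through the product \<open>a * b\<close> avoids division, so a weight may be zero.\<close>

lemma scalar_prod_weighted_AMGM:
  fixes x y :: "real vec"
  assumes x: "x \<in> carrier_vec n" and y: "y \<in> carrier_vec n"
    and ab: "0 \<le> a" "0 \<le> b" and S: "0 \<le> S"
    and le: "y \<bullet> y \<le> a * b * S"
  shows "2 * (x \<bullet> y) \<le> a * (x \<bullet> x) + b * S"
proof -
  have x0: "0 \<le> x \<bullet> x" by (rule scalar_prod_self_nonneg)
  have "(2 * (x \<bullet> y))\<^sup>2 \<le> 4 * ((x \<bullet> x) * (y \<bullet> y))"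
    using scalar_prod_Cauchy_Schwarz[OF x y] by (simp add: power_mult_distrib)
  also have "\<dots> \<le> 4 * ((x \<bullet> x) * (a * b * S))"
    using mult_left_mono[OF le x0] by simp
  also have "\<dots> \<le> (a * (x \<bullet> x) + b * S)\<^sup>2"
    using zero_le_power2[of "a * (x \<bullet> x) - b * S"]
    by (simp add: power2_eq_square algebra_simps)
  finally show ?thesis
    by (rule power2_le_imp_le) (use x0 ab S in simp)
qed

section \<open>The largest eigenvalue as maximum of the Rayleigh quotient\<close>

lemma positive_semidefinite_kernel:
  fixes B :: "real mat"
  assumes B: "B \<in> carrier_mat n n" and sym: "B\<^sup>T = B"
    and psd: "\<And>y. y \<in> carrier_vec n \<Longrightarrow> 0 \<le> y \<bullet> (B *\<^sub>v y)"
    and x: "x \<in> carrier_vec n" and x0: "x \<bullet> (B *\<^sub>v x) = 0"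
  shows "B *\<^sub>v x = 0\<^sub>v n"
proof -
  define r where "r = B *\<^sub>v x"
  have r: "r \<in> carrier_vec n" and Br: "B *\<^sub>v r \<in> carrier_vec n"
    using B x by (auto simp: r_def)
  have xBr: "x \<bullet> (B *\<^sub>v r) = r \<bullet> r"
    using transpose_vec_mult_scalar[OF B r x] sym by (simp add: r_def)
  define R Q where "R = r \<bullet> r" and "Q = r \<bullet> (B *\<^sub>v r)"
  have Q: "0 \<le> Q" using psd[OF r] by (simp add: Q_def)
  \<comment> \<open>At \<open>x + t \<cdot>\<^sub>v r\<close> the constant term vanishes by
    \<open>x0\<close>, and symmetry of \<open>B\<close> makes both mixed terms \<open>t * R\<close>.
    A nonzero \<open>R\<close> would make this negative for small negative \<open>t\<close>.\<close>
  have quad: "0 \<le> 2 * t * R + t\<^sup>2 * Q" for t :: real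
  proof -
    have tr: "t \<cdot>\<^sub>v r \<in> carrier_vec n" using r by simp
    have tBr: "t \<cdot>\<^sub>v (B *\<^sub>v r) \<in> carrier_vec n" using Br by simp
    have "B *\<^sub>v (x + t \<cdot>\<^sub>v r) = r + t \<cdot>\<^sub>v (B *\<^sub>v r)"
      using mult_add_distrib_mat_vec[OF B x tr] mult_mat_vec[OF B r] by (simp add: r_def)
    then have "(x + t \<cdot>\<^sub>v r) \<bullet> (B *\<^sub>v (x + t \<cdot>\<^sub>v r)) = 2 * t * R + t\<^sup>2 * Q"
      using x r Br tr tBr x0 xBr
      by (simp add: add_scalar_prod_distrib[of _ n] scalar_prod_add_distrib[of _ n]
          r_def[symmetric] R_def Q_def power2_eq_square)
    then show ?thesis using psd[of "x + t \<cdot>\<^sub>v r"] x tr by simp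
  qed
  have "R = 0"
  proof (rule ccontr)
    assume "R \<noteq> 0"
    then have R: "R > 0" using scalar_prod_self_nonneg[of r] by (simp add: R_def)
    \<comment> \<open>With \<open>R = u * (Q + 1)\<close> the value at \<open>t = - u\<close> is
      \<open>- (u\<^sup>2 * (Q + 2))\<close>; the summand 1 keeps the denominator positive when
      \<open>Q = 0\<close>.\<close>
    define u where "u = R / (Q + 1)"
    have "u > 0" using R Q by (simp add: u_def)
    have "R = u * (Q + 1)" using Q by (simp add: u_def)
    then have "2 * (- u) * R + (- u)\<^sup>2 * Q = - (u\<^sup>2 * (Q + 2))"
      by (simp add: power2_eq_square algebra_simps)
    moreover have "u\<^sup>2 * (Q + 2) > 0" using \<open>u > 0\<close> Q by simp
    ultimately show False using quad[of "- u"] by linarith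
  qed
  then show ?thesis using scalar_prod_self_eq_0_iff[OF r] by (simp add: R_def r_def)
qed

text \<open>Compactness of the unit sphere, with vectors modelled as functions
  \<open>nat \<Rightarrow> real\<close> under the product topology.\<close>

lemma quadratic_form_attains_max:
  fixes A :: "real mat"
  assumes A: "A \<in> carrier_mat n n" and n: "n > 0"
  obtains x where "x \<in> carrier_vec n" "x \<bullet> x = 1"
    "\<And>y. y \<in> carrier_vec n \<Longrightarrow> y \<bullet> y = 1 \<Longrightarrow> y \<bullet> (A *\<^sub>v y) \<le> x \<bullet> (A *\<^sub>v x)"
proof -
  define sq where "sq = (\<lambda>f :: nat \<Rightarrow> real. \<Sum>i<n. (f i)\<^sup>2)"
  define q where "q = (\<lambda>f :: nat \<Rightarrow> real. \<Sum>i<n. f i * (\<Sum>j<n. A $$ (i, j) * f j))"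
  \<comment> \<open>Pinning the coordinates from \<open>n\<close> on to 0 makes every factor
    compact, so Tychonoff's theorem applies; the sphere is closed in this product.\<close>
  define K where "K = PiE UNIV (\<lambda>i. if i < n then {-1..1} else {0 :: real}) \<inter> {f. sq f = 1}"
  have coord: "continuous_on UNIV (\<lambda>f :: nat \<Rightarrow> real. f i)" for i by simp
  have "continuous_on UNIV sq" unfolding sq_def by (intro continuous_intros coord)
  then have "closed {f. sq f = 1}"
    using continuous_on_closed_vimage[of UNIV sq] by (auto simp: vimage_def)
  moreover have "compact (PiE UNIV (\<lambda>i. if i < n then {-1..1} else {0 :: real}))"
    using compactin_PiE[of "\<lambda>_. euclidean" UNIV "\<lambda>i. if i < n then {-1..1} else {0 :: real}"]
    by (simp add: euclidean_product_topology)
  ultimately have cK: "compact K" unfolding K_def by (rule compact_Int_closed[rotated])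
  have sqv: "y \<bullet> y = sq (\<lambda>i. y $ i)" if "y \<in> carrier_vec n" for y
    using that by (simp add: sq_def scalar_prod_def power2_eq_square lessThan_atLeast0)
  have qv: "y \<bullet> (A *\<^sub>v y) = q (\<lambda>i. y $ i)" if "y \<in> carrier_vec n" for y
    using that A by (simp add: q_def scalar_prod_def lessThan_atLeast0)
  have ext: "sq (\<lambda>i. if i < n then f i else 0) = sq f" "q (\<lambda>i. if i < n then f i else 0) = q f" for f
    by (simp_all add: sq_def q_def)
  have inK: "(\<lambda>i. if i < n then f i else 0) \<in> K" if "sq f = 1" for f
  proof -
    have "\<bar>f i\<bar> \<le> 1" if "i < n" for i
    proof -
      have "(f i)\<^sup>2 \<le> sq f" unfolding sq_def by (rule member_le_sum) (use that in auto)
      then show ?thesis using \<open>sq f = 1\<close> by (simp add: abs_square_le_1)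
    qed
    then show ?thesis using that ext(1) by (auto simp: K_def abs_le_iff)
  qed
  have "sq (\<lambda>i. if i = 0 then 1 else 0) = 1"
    using n by (simp add: sq_def if_distrib[of "\<lambda>x. x\<^sup>2"] sum.delta cong: if_cong)
  then have "K \<noteq> {}" using inK by blast
  moreover have "continuous_on K q"
    unfolding q_def by (intro continuous_intros continuous_on_subset[OF coord]) auto
  ultimately obtain f where f: "f \<in> K" and max: "\<And>g. g \<in> K \<Longrightarrow> q g \<le> q f"
    using continuous_attains_sup[OF cK] by blast
  have vf: "sq (\<lambda>i. vec n f $ i) = sq f" "q (\<lambda>i. vec n f $ i) = q f"
    by (simp_all add: sq_def q_def)
  show thesis
  proof (rule that[of "vec n f"])
    show "vec n f \<bullet> vec n f = 1" using f by (simp add: sqv vf K_def)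
    fix y :: "real vec" assume y: "y \<in> carrier_vec n" "y \<bullet> y = 1"
    then show "y \<bullet> (A *\<^sub>v y) \<le> vec n f \<bullet> (A *\<^sub>v vec n f)"
      using max[OF inK[of "\<lambda>i. y $ i"]] by (simp add: sqv qv vf ext)
  qed simp
qed

text \<open>By homogeneity the maximum \<open>m\<close> on the unit sphere bounds the form
  everywhere, and \<open>m\<close> is itself an eigenvalue, hence at most
  \<open>lambda_max A\<close>.\<close>

lemma quadratic_form_le_lambda_max:
  fixes A :: "real mat"
  assumes A: "A \<in> carrier_mat n n" and sym: "A\<^sup>T = A" and y: "y \<in> carrier_vec n"
  shows "y \<bullet> (A *\<^sub>v y) \<le> lambda_max A * (y \<bullet> y)"
proof (cases "n = 0")
  \<comment> \<open>Here the spectrum is empty and \<open>lambda_max A\<close> unspecified, but both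
    sides are 0.\<close>
  case True
  then show ?thesis using y by (simp add: scalar_prod_def)
next
  case False
  then obtain x where x: "x \<in> carrier_vec n" "x \<bullet> x = 1"
    and max: "\<And>y. y \<in> carrier_vec n \<Longrightarrow> y \<bullet> y = 1 \<Longrightarrow> y \<bullet> (A *\<^sub>v y) \<le> x \<bullet> (A *\<^sub>v x)"
    using quadratic_form_attains_max[OF A] by blast
  define m where "m = x \<bullet> (A *\<^sub>v x)"
  have le_m: "y \<bullet> (A *\<^sub>v y) \<le> m * (y \<bullet> y)" if y: "y \<in> carrier_vec n" for y
  proof (cases "y \<bullet> y = 0")
    case True
    then have "y = 0\<^sub>v n" using scalar_prod_self_eq_0_iff[OF y] by simp
    then show ?thesis using A by simp
  next
    case False
    define c where "c = 1 / sqrt (y \<bullet> y)"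
    have pos: "y \<bullet> y > 0" using False scalar_prod_self_nonneg[of y] by linarith
    then have c: "c * c * (y \<bullet> y) = 1" by (simp add: c_def)
    have Ay: "A *\<^sub>v y \<in> carrier_vec n" using A y by simp
    have "c * c * (y \<bullet> (A *\<^sub>v y)) \<le> m"
      using max[of "c \<cdot>\<^sub>v y"] y Ay c by (simp add: mult_mat_vec[OF A y] m_def mult.assoc)
    then have "c * c * (y \<bullet> (A *\<^sub>v y)) * (y \<bullet> y) \<le> m * (y \<bullet> y)"
      using pos by (intro mult_right_mono) auto
    moreover have "c * c * (y \<bullet> (A *\<^sub>v y)) * (y \<bullet> y) = c * c * (y \<bullet> y) * (y \<bullet> (A *\<^sub>v y))"
      by (simp add: ac_simps)
    ultimately show ?thesis using c by simp
  qed
  define B where "B = m \<cdot>\<^sub>m 1\<^sub>m n - A"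
  have B: "B \<in> carrier_mat n n" using A by (simp add: B_def minus_carrier_mat)
  have "A $$ (j, i) = A $$ (i, j)" if "i < n" "j < n" for i j
    using index_transpose_mat(1)[of i A j] A that sym by simp
  then have Bsym: "B\<^sup>T = B"
    using A by (intro eq_matI) (auto simp: B_def)
  have Bv: "B *\<^sub>v y = m \<cdot>\<^sub>v y - A *\<^sub>v y" if "y \<in> carrier_vec n" for y
  proof -
    have "m \<cdot>\<^sub>m 1\<^sub>m n *\<^sub>v y = m \<cdot>\<^sub>v y"
      using that by (intro eq_vecI) auto
    then show ?thesis using that A by (simp add: B_def minus_mult_distrib_mat_vec[of _ n n])
  qed
  have Bform: "y \<bullet> (B *\<^sub>v y) = m * (y \<bullet> y) - y \<bullet> (A *\<^sub>v y)" if "y \<in> carrier_vec n" for y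
    using that A by (simp add: Bv scalar_prod_minus_distrib[of _ n])
  \<comment> \<open>A maximiser of the Rayleigh quotient is a null vector of \<open>m 1 - A\<close>, i.e. an eigenvector for \<open>m\<close>.\<close>
  have "B *\<^sub>v x = 0\<^sub>v n"
    by (rule positive_semidefinite_kernel[OF B Bsym _ x(1)])
      (use le_m x in \<open>auto simp: Bform m_def\<close>)
  then have "m \<cdot>\<^sub>v x - A *\<^sub>v x = 0\<^sub>v n" using Bv[OF x(1)] by simp
  then have "A *\<^sub>v x = m \<cdot>\<^sub>v x"
    using A x(1) by (auto simp: vec_eq_iff)
  moreover have "x \<noteq> 0\<^sub>v n" using x by auto
  ultimately have "m \<in> spectrum A"
    using A x(1) by (auto simp: spectrum_def eigenvalue_def eigenvector_def)
  then have "m \<le> lambda_max A"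
    unfolding lambda_max_def using card_finite_spectrum(1)[OF A] by (intro Max_ge)
  then show ?thesis
    using le_m[OF y] mult_right_mono[OF _ scalar_prod_self_nonneg[of y]] by fastforce
qed

lemma mult_mat_vec_self_le_lambda_max:
  fixes A :: "real mat"
  assumes A: "A \<in> carrier_mat m n" and x: "x \<in> carrier_vec n"
  shows "(A *\<^sub>v x) \<bullet> (A *\<^sub>v x) \<le> lambda_max (A\<^sup>T * A) * (x \<bullet> x)"
proof -
  have "(A\<^sup>T * A)\<^sup>T = A\<^sup>T * A" using A by (simp add: transpose_mult[of _ n m _ n])
  then have "x \<bullet> ((A\<^sup>T * A) *\<^sub>v x) \<le> lambda_max (A\<^sup>T * A) * (x \<bullet> x)"
    using A x by (intro quadratic_form_le_lambda_max[of _ n]) auto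
  moreover have "x \<bullet> ((A\<^sup>T * A) *\<^sub>v x) = (A *\<^sub>v x) \<bullet> (A *\<^sub>v x)"
    using A x transpose_vec_mult_scalar[OF A x, of "A *\<^sub>v x"]
    by (simp add: comm_scalar_prod[of x n] assoc_mult_mat_vec[of _ n m])
  ultimately show ?thesis by simp
qed

text \<open>The Gram bound is tested on a unit vector, which exists because
  \<open>n > 0\<close>.\<close>

lemma lambda_max_gram_nonneg:
  fixes A :: "real mat"
  assumes A: "A \<in> carrier_mat m n" and n: "n > 0"
  shows "0 \<le> lambda_max (A\<^sup>T * A)"
  using mult_mat_vec_self_le_lambda_max[OF A, of "unit_vec n 0"] n
    scalar_prod_self_nonneg[of "A *\<^sub>v unit_vec n 0"] by simp

section \<open>Block decomposition of vectors and of the bidiagonal matrix\<close>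

definition block :: "nat \<Rightarrow> 'a vec \<Rightarrow> nat \<Rightarrow> 'a vec" where
  "block s w k = vec s (\<lambda>i. w $ (k * s + i))"

lemma block_carrier [simp]: "block s w k \<in> carrier_vec s"
  by (simp add: block_def)

lemma sum_blocks:
  fixes f :: "nat \<Rightarrow> 'a :: comm_monoid_add"
  shows "(\<Sum>j<n * s. f j) = (\<Sum>k<n. \<Sum>i<s. f (k * s + i))"
proof -
  have "sum f {k * s..<k * s + s} = (\<Sum>i<s. f (k * s + i))" for k
    using sum.shift_bounds_nat_ivl[of f 0 "k * s" s] by (simp add: lessThan_atLeast0 ac_simps)
  then show ?thesis by (simp add: sum.nat_group[symmetric])
qed

lemma scalar_prod_blocks:
  assumes "w \<in> carrier_vec (n * s)"
  shows "w \<bullet> w = (\<Sum>k<n. block s w k \<bullet> block s w k)"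
  using assms sum_blocks[of "\<lambda>i. w $ i * w $ i" n s]
  by (simp add: scalar_prod_def block_def lessThan_atLeast0)

lemma L_mat_carrier: "L_mat N s M \<in> carrier_mat ((N + 1) * s) ((N + 1) * s)"
  by (simp add: L_mat_def)

lemma block_index_less:
  fixes k i s n :: nat
  assumes "k < n" "i < s"
  shows "k * s + i < n * s"
proof -
  have "k * s + i < Suc k * s" using assms by simp
  also have "\<dots> \<le> n * s" using assms by (intro mult_le_mono1) simp
  finally show ?thesis .
qed

text \<open>Writing the column index as \<open>q * s + j\<close> turns the \<open>div\<close> and
  \<open>mod\<close> tests of \<open>L_mat\<close> into comparisons of \<open>q\<close> with
  \<open>k\<close>; only block columns \<open>k\<close> and \<open>k - 1\<close> survive. The case
  \<open>k = 0\<close> is separate because \<open>k - 1\<close> truncates.\<close>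

lemma L_mat_mult_vec_index:
  assumes w: "w \<in> carrier_vec ((N + 1) * s)" and k: "k \<le> N" and i: "i < s"
  shows "(L_mat N s M *\<^sub>v w) $ (k * s + i) = w $ (k * s + i) -
    (if k = 0 then 0 else \<Sum>j<s. M k $$ (i, j) * w $ ((k - 1) * s + j))"
proof -
  let ?g = "\<lambda>q j. (if k = q then if i = j then 1 else 0
    else if k = Suc q then - M k $$ (i, j) else 0) * w $ (q * s + j)"
  have less: "q * s + j < (N + 1) * s" if "q < N + 1" "j < s" for q j
    using block_index_less[OF that] .
  have "(L_mat N s M *\<^sub>v w) $ (k * s + i)
      = (\<Sum>p<(N + 1) * s. L_mat N s M $$ (k * s + i, p) * w $ p)"
    using less[of k i] w k i by (simp add: scalar_prod_def lessThan_atLeast0 L_mat_def)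
  also have "\<dots> = (\<Sum>q<N + 1. \<Sum>j<s. ?g q j)"
    unfolding sum_blocks
  proof (intro sum.cong refl)
    fix q j assume "q \<in> {..<N + 1}" "j \<in> {..<s}"
    then have q: "q < N + 1" and j: "j < s" and k': "k < N + 1" using k by auto
    have divmod: "(k * s + i) div s = k" "(k * s + i) mod s = i" "(q * s + j) div s = q" "(q * s + j) mod s = j"
      using i j by auto
    show "L_mat N s M $$ (k * s + i, q * s + j) * w $ (q * s + j) = ?g q j"
      unfolding L_mat_def index_mat(1)[OF less[OF k' i] less[OF q j]] prod.case divmod
      using i j by simp
  qed
  also have "\<dots> = (\<Sum>q<N + 1. (if q = k then w $ (k * s + i) else 0)
      + (if k = Suc q then - (\<Sum>j<s. M k $$ (i, j) * w $ (q * s + j)) else 0))"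
  proof (intro sum.cong refl)
    fix q
    have "(\<Sum>j<s. (if i = j then 1 else 0) * w $ (q * s + j)) = w $ (q * s + i)"
      using i by (simp add: if_distrib[of "\<lambda>x. x * _"] sum.delta cong: if_cong)
    then show "(\<Sum>j<s. ?g q j) = (if q = k then w $ (k * s + i) else 0)
      + (if k = Suc q then - (\<Sum>j<s. M k $$ (i, j) * w $ (q * s + j)) else 0)"
      by (auto simp: sum_negf)
  qed
  also have "\<dots> = w $ (k * s + i) -
    (if k = 0 then 0 else \<Sum>j<s. M k $$ (i, j) * w $ ((k - 1) * s + j))"
  proof (cases k)
    case (Suc m)
    then show ?thesis using k by (simp add: sum.distrib sum.delta sum.delta' del: sum.lessThan_Suc)
  qed (simp add: sum.distrib sum.delta del: sum.lessThan_Suc)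
  finally show ?thesis .
qed

lemma block_L_mat_0:
  assumes "w \<in> carrier_vec ((N + 1) * s)"
  shows "block s (L_mat N s M *\<^sub>v w) 0 = block s w 0"
  using L_mat_mult_vec_index[OF assms, of 0] by (auto simp: block_def)

lemma block_L_mat_Suc:
  assumes "w \<in> carrier_vec ((N + 1) * s)" "k < N" "M (Suc k) \<in> carrier_mat s s"
  shows "block s (L_mat N s M *\<^sub>v w) (Suc k) = block s w (Suc k) - M (Suc k) *\<^sub>v block s w k"
  using L_mat_mult_vec_index[OF assms(1), of "Suc k"] assms
  by (intro eq_vecI) (auto simp: block_def scalar_prod_def lessThan_atLeast0)

section \<open>Blockwise norm estimates\<close>

lemma rho_eq_geometric_sum:
  "rho N Mhat D = (\<Sum>j<N. lambda_max (Mhat\<^sup>T * Mhat) ^ j) *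
     (MAX m\<in>{1..N}. lambda_max ((D m)\<^sup>T * D m))"
  by (simp add: rho_def Let_def sum_gp_strict)

text \<open>The geometric sum arises from its own recursion \<open>G (Suc k) = 1 + l * G k\<close>:
  applying \<open>Mhat\<close> costs a factor \<open>l\<close> in the squared norm.\<close>

lemma recursion_square_bound:
  fixes Mhat :: "real mat" and a b :: "nat \<Rightarrow> real vec"
  defines "l \<equiv> lambda_max (Mhat\<^sup>T * Mhat)"
  assumes Mhat: "Mhat \<in> carrier_mat s s" and s: "s > 0"
    and a: "\<And>k. a k \<in> carrier_vec s" and b: "\<And>k. b k \<in> carrier_vec s"
    and b0: "b 0 = a 0" and bSuc: "\<And>k. k < N \<Longrightarrow> b (Suc k) = a (Suc k) + Mhat *\<^sub>v b k"
  shows "k \<le> N \<Longrightarrow> b k \<bullet> b k \<le> (\<Sum>j\<le>k. l ^ j) * (\<Sum>j\<le>k. a j \<bullet> a j)"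
proof (induction k)
  case 0
  then show ?case by (simp add: b0)
next
  case (Suc k)
  define g where "g = l * (\<Sum>j\<le>k. l ^ j)"
  define S where "S = (\<Sum>j\<le>k. a j \<bullet> a j)"
  have l: "0 \<le> l" unfolding l_def by (rule lambda_max_gram_nonneg[OF Mhat s])
  then have g: "0 \<le> g" by (simp add: g_def sum_nonneg)
  have S: "0 \<le> S" by (simp add: S_def sum_nonneg scalar_prod_self_nonneg)
  let ?y = "Mhat *\<^sub>v b k"
  have y: "?y \<in> carrier_vec s" using Mhat b by simp
  have "?y \<bullet> ?y \<le> l * (b k \<bullet> b k)"
    unfolding l_def by (rule mult_mat_vec_self_le_lambda_max[OF Mhat b])
  also have "\<dots> \<le> g * S"
    using Suc mult_left_mono[OF _ l] by (simp add: g_def S_def mult.assoc)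
  finally have yy: "?y \<bullet> ?y \<le> g * S" .
  \<comment> \<open>The weights \<open>g\<close> and 1 give both
    \<open>a (Suc k) \<bullet> a (Suc k)\<close> and \<open>S\<close> the total coefficient
    \<open>1 + g\<close>.\<close>
  then have "2 * (a (Suc k) \<bullet> ?y) \<le> g * (a (Suc k) \<bullet> a (Suc k)) + 1 * S"
    by (intro scalar_prod_weighted_AMGM[OF a y]) (use g S in simp_all)
  then have "b (Suc k) \<bullet> b (Suc k) \<le> (1 + g) * (S + a (Suc k) \<bullet> a (Suc k))"
    using yy Suc.prems bSuc[of k] scalar_prod_self_add[OF a y, of "Suc k"]
    by (simp add: algebra_simps)
  moreover have "(\<Sum>j\<le>Suc k. l ^ j) = 1 + g"
    by (simp add: g_def sum.atMost_Suc_shift sum_distrib_left del: sum.atMost_Suc)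
  ultimately show ?case by (simp add: S_def del: sum.atMost_Suc add: sum.atMost_Suc[of "\<lambda>j. a j \<bullet> a j"])
qed

text \<open>Comparing the two matrices on an arbitrary \<open>w\<close> keeps the inverse of
  \<open>Lhat\<close> out of the estimate.\<close>

lemma L_mat_square_le:
  fixes N s :: nat and M D :: "nat \<Rightarrow> real mat" and Mhat :: "real mat" and w :: "real vec"
  defines "u \<equiv> L_mat N s M *\<^sub>v w" and "v \<equiv> L_mat N s (\<lambda>_. Mhat) *\<^sub>v w" and "r \<equiv> rho N Mhat D"
  assumes N: "N \<ge> 1" and s: "s \<ge> 1"
    and M: "\<And>i. i \<in> {1..N} \<Longrightarrow> M i \<in> carrier_mat s s"
    and Mhat: "Mhat \<in> carrier_mat s s"
    and D: "\<And>i. i \<in> {1..N} \<Longrightarrow> D i = Mhat - M i"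
    and w: "w \<in> carrier_vec ((N + 1) * s)"
  shows "u \<bullet> u \<le> (1 + real N / 2 * (r + sqrt (r\<^sup>2 + 4 * r))) * (v \<bullet> v)"
proof -
  define l where "l = lambda_max (Mhat\<^sup>T * Mhat)"
  define d where "d = (MAX m\<in>{1..N}. lambda_max ((D m)\<^sup>T * D m))"
  \<comment> \<open>The larger root of \<open>c * (c - r) = r\<close>; this factors \<open>r\<close>
    into the two weights used for the mixed term below.\<close>
  define c where "c = (r + sqrt (r\<^sup>2 + 4 * r)) / 2"
  define a b where "a = block s v" and "b = block s w"
  define S where "S = (\<lambda>k. \<Sum>j\<le>k. a j \<bullet> a j)"
  have Dc: "D m \<in> carrier_mat s s" if "m \<in> {1..N}" for m
    using D[OF that] M[OF that] Mhat by (simp add: minus_carrier_mat)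
  have l: "0 \<le> l" unfolding l_def using lambda_max_gram_nonneg[OF Mhat] s by simp
  have le_d: "lambda_max ((D m)\<^sup>T * D m) \<le> d" if "m \<in> {1..N}" for m
    unfolding d_def using that by (intro Max_ge) auto
  have d: "0 \<le> d"
    using le_d[of 1] lambda_max_gram_nonneg[OF Dc[of 1]] N s by fastforce
  \<comment> \<open>A single geometric sum covers both cases of \<open>rho\<close>, including
    \<open>l = 1\<close>.\<close>
  have r_eq: "r = (\<Sum>j<N. l ^ j) * d"
    unfolding r_def l_def d_def by (rule rho_eq_geometric_sum)
  have r: "0 \<le> r" unfolding r_eq using l d by (intro mult_nonneg_nonneg sum_nonneg) auto
  have "sqrt (r\<^sup>2) \<le> sqrt (r\<^sup>2 + 4 * r)" using r by (intro real_sqrt_le_mono) simp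
  then have cr: "r \<le> c" using r by (simp add: c_def)
  have "(sqrt (r\<^sup>2 + 4 * r))\<^sup>2 = r\<^sup>2 + 4 * r" using r by (intro real_sqrt_pow2) simp
  then have c_root: "c * (c - r) = r" by (simp add: c_def power2_eq_square field_simps)
  have ac: "a k \<in> carrier_vec s" and bc: "b k \<in> carrier_vec s" for k by (simp_all add: a_def b_def)
  have a0: "b 0 = a 0" unfolding a_def b_def v_def by (rule block_L_mat_0[OF w, symmetric])
  have bSuc: "b (Suc k) = a (Suc k) + Mhat *\<^sub>v b k" if "k < N" for k
    using block_L_mat_Suc[OF w that, of "\<lambda>_. Mhat"] Mhat ac bc
    by (auto simp: a_def b_def v_def vec_eq_iff)
  have S0: "0 \<le> S k" for k unfolding S_def by (intro sum_nonneg scalar_prod_self_nonneg)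
  have vc: "v \<in> carrier_vec ((N + 1) * s)" and uc: "u \<in> carrier_vec ((N + 1) * s)"
    using w L_mat_carrier by (auto simp: u_def v_def intro!: mult_mat_vec_carrier)
  have SN: "S N = v \<bullet> v"
    using scalar_prod_blocks[OF vc] by (simp add: S_def a_def lessThan_Suc_atMost)
  have S_le: "S k \<le> S N" if "k \<le> N" for k
    unfolding S_def using that by (intro sum_mono2 scalar_prod_self_nonneg) auto
  have step: "block s u (Suc k) \<bullet> block s u (Suc k) \<le> a (Suc k) \<bullet> a (Suc k) + c * S N"
    if k: "k < N" for k
  proof -
    let ?z = "D (Suc k) *\<^sub>v b k"
    have m: "Suc k \<in> {1..N}" using k by simp
    have z: "?z \<in> carrier_vec s" using Dc[OF m] bc by simp
    have "?z = Mhat *\<^sub>v b k - M (Suc k) *\<^sub>v b k"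
      using D[OF m] M[OF m] Mhat bc by (simp add: minus_mult_distrib_mat_vec[of _ s s])
    then have u_eq: "block s u (Suc k) = a (Suc k) + ?z"
      using block_L_mat_Suc[where M = M, OF w k M[OF m]] bSuc[OF k] ac bc M[OF m] Mhat
      by (auto simp: u_def b_def[symmetric] vec_eq_iff)
    have "?z \<bullet> ?z \<le> d * (b k \<bullet> b k)"
      using mult_mat_vec_self_le_lambda_max[OF Dc[OF m] bc, of k]
        mult_right_mono[OF le_d[OF m] scalar_prod_self_nonneg[of "b k"]] by linarith
    also have "\<dots> \<le> d * ((\<Sum>j\<le>k. l ^ j) * S k)"
      using recursion_square_bound[where a = a and b = b, OF Mhat _ ac bc a0 bSuc, of N k] k s d
      by (intro mult_left_mono) (auto simp: l_def S_def)
    \<comment> \<open>\<open>D (Suc k)\<close> acts on the preceding block \<open>b k\<close> with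
      \<open>k < N\<close>, so \<open>N\<close> powers of \<open>l\<close> suffice although there
      are \<open>N + 1\<close> blocks.\<close>
    also have "\<dots> \<le> d * ((\<Sum>j<N. l ^ j) * S k)"
      using l d S0 k by (intro mult_left_mono mult_right_mono sum_mono2) auto
    also have "\<dots> = c * (c - r) * S k" unfolding c_root by (simp add: r_eq)
    finally have zz: "?z \<bullet> ?z \<le> c * (c - r) * S k" .
    \<comment> \<open>The share \<open>(c - r) * S k\<close> of the mixed term and the bound
      \<open>r * S k\<close> on \<open>?z \<bullet> ?z\<close> add up to \<open>c * S k\<close>,
      matching the coefficient of \<open>a (Suc k) \<bullet> a (Suc k)\<close>.\<close>
    then have "2 * (a (Suc k) \<bullet> ?z) \<le> c * (a (Suc k) \<bullet> a (Suc k)) + (c - r) * S k"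
      by (intro scalar_prod_weighted_AMGM[OF ac z]) (use r cr S0 in simp_all)
    moreover have "?z \<bullet> ?z \<le> r * S k" using zz c_root by simp
    ultimately have "block s u (Suc k) \<bullet> block s u (Suc k)
        \<le> a (Suc k) \<bullet> a (Suc k) + c * S (Suc k)"
      unfolding u_eq scalar_prod_self_add[OF ac z] by (simp add: S_def algebra_simps)
    also have "\<dots> \<le> a (Suc k) \<bullet> a (Suc k) + c * S N"
      using S_le[of "Suc k"] k r cr by (intro add_left_mono mult_left_mono) auto
    finally show ?thesis .
  qed
  have "u \<bullet> u = (\<Sum>k\<le>N. block s u k \<bullet> block s u k)"
    using scalar_prod_blocks[OF uc] by (simp add: lessThan_Suc_atMost)
  \<comment> \<open>Block 0 of \<open>u\<close> and \<open>v\<close> is the same, so only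
    \<open>N\<close> blocks contribute an excess.\<close>
  also have "\<dots> = a 0 \<bullet> a 0 + (\<Sum>k<N. block s u (Suc k) \<bullet> block s u (Suc k))"
    using block_L_mat_0[OF w, of M] a0 by (simp add: sum.atMost_shift u_def b_def)
  also have "\<dots> \<le> a 0 \<bullet> a 0 + (\<Sum>k<N. a (Suc k) \<bullet> a (Suc k) + c * S N)"
    using step by (intro add_left_mono sum_mono) auto
  also have "\<dots> = S N + real N * c * S N"
    by (simp add: S_def sum.atMost_shift sum.distrib)
  also have "\<dots> = (1 + real N / 2 * (r + sqrt (r\<^sup>2 + 4 * r))) * (v \<bullet> v)"
    by (simp add: SN c_def algebra_simps)
  finally show ?thesis .
qed

section \<open>From an eigenvector to the norm comparison\<close>

theorem proposition2:
  fixes N s :: nat and M D :: "nat \<Rightarrow> real mat" and Mhat L Lhat :: "real mat" and \<mu> :: real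
  assumes "N \<ge> 1" and "s \<ge> 1"
    and "\<And>i. i \<in> {1..N} \<Longrightarrow> M i \<in> carrier_mat s s"
    and "Mhat \<in> carrier_mat s s"
    and "\<And>i. i \<in> {1..N} \<Longrightarrow> D i = Mhat - M i"
    and "L = L_mat N s M"
    and "Lhat = Lhat_mat N s Mhat"
    and "eigenvalue ((inv_mat Lhat)\<^sup>T * L\<^sup>T * L * inv_mat Lhat) \<mu>"
  shows "\<mu> \<le> 1 + real N / 2 * (rho N Mhat D + sqrt ((rho N Mhat D)\<^sup>2 + 4 * rho N Mhat D))"
proof -
  let ?n = "(N + 1) * s"
  define P where "P = inv_mat Lhat"
  have P: "P \<in> carrier_mat ?n ?n" and LP: "Lhat * P = 1\<^sub>m ?n"
    unfolding P_def \<open>Lhat = Lhat_mat N s Mhat\<close> by (rule inv_mat_Lhat[OF assms(4)])+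
  have Lhat_eq: "Lhat = L_mat N s (\<lambda>_. Mhat)"
    using Lhat_mat_eq_L_mat[OF assms(4)] assms(7) by simp
  have L: "L \<in> carrier_mat ?n ?n" and Lhat: "Lhat \<in> carrier_mat ?n ?n"
    unfolding Lhat_eq \<open>L = L_mat N s M\<close> by (rule L_mat_carrier)+
  have LPc: "L * P \<in> carrier_mat ?n ?n" using L P by simp
  \<comment> \<open>As a Gram matrix of \<open>L * P\<close>, the product paired with
    \<open>v\<close> yields a squared norm.\<close>
  have gram: "P\<^sup>T * L\<^sup>T * L * P = (L * P)\<^sup>T * (L * P)"
    using L P by (simp add: transpose_mult[of _ ?n ?n _ ?n] assoc_mult_mat[of _ ?n ?n _ ?n _ ?n])
  obtain v where v: "v \<in> carrier_vec ?n" "v \<noteq> 0\<^sub>v ?n"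
    and ev: "((L * P)\<^sup>T * (L * P)) *\<^sub>v v = \<mu> \<cdot>\<^sub>v v"
    using assms(8) P unfolding P_def[symmetric] gram eigenvalue_def eigenvector_def by auto
  define w where "w = P *\<^sub>v v"
  have w: "w \<in> carrier_vec ?n" using P v by (simp add: w_def)
  have Lhat_w: "Lhat *\<^sub>v w = v"
    using assoc_mult_mat_vec[OF Lhat P v(1)] LP v by (simp add: w_def)
  have L_w: "(L * P) *\<^sub>v v = L *\<^sub>v w"
    using assoc_mult_mat_vec[OF L P v(1)] by (simp add: w_def)
  have Lw: "L *\<^sub>v w \<in> carrier_vec ?n" using L w by simp
  have pos: "v \<bullet> v > 0"
    using v scalar_prod_self_eq_0_iff[OF v(1)] scalar_prod_self_nonneg[of v] by linarith
  have ev': "\<mu> \<cdot>\<^sub>v v = (L * P)\<^sup>T *\<^sub>v (L *\<^sub>v w)"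
    using ev LPc L_w v(1) assoc_mult_mat_vec[of "(L * P)\<^sup>T" ?n ?n "L * P" ?n v] by simp
  have "\<mu> * (v \<bullet> v) = ((L * P)\<^sup>T *\<^sub>v (L *\<^sub>v w)) \<bullet> v"
    unfolding ev'[symmetric] using v(1) by simp
  also have "\<dots> = (L *\<^sub>v w) \<bullet> (L *\<^sub>v w)"
    using transpose_vec_mult_scalar[OF LPc v(1) Lw] L_w by simp
  also have "\<dots> \<le> (1 + real N / 2 * (rho N Mhat D + sqrt ((rho N Mhat D)\<^sup>2 + 4 * rho N Mhat D)))
      * (v \<bullet> v)"
    using L_mat_square_le[OF assms(1-5) w] Lhat_w Lhat_eq assms(6) by simp
  finally show ?thesis using pos by (simp add: mult_le_cancel_right)
qed

end
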